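(* Let $k\ge 1$ be an integer. If $n\geq\binom{2k-1}{k-1}$ and $G$ is a graph of order $n$, then $$\lambda_{k}(G)\geq -1\quad\text{and}\quad \lambda_{n-k+1}(G)\leq 0.$$
   Context: Graphs are finite, simple and undirected; the order of a graph is its number of vertices. For a graph $G$ of order $n$, $\lambda_1(G)\ge\cdots\ge\lambda_n(G)$ denote the eigenvalues of its adjacency matrix, with multiplicity. *)

theory Defs
  imports
    "Graph_Theory.Digraph"
    "Jordan_Normal_Form.Char_Poly"
begin

text \<open>
  A finite simple undirected graph is a \<^locale>\<open>graph\<close>: a finite digraph
  without loops and parallel arcs whose arc relation is symmetric, every edge being represented
  by its two opposite arcs.

  The list \<open>vs\<close> enumerates the vertices and indexes rows and columns.
\<close>

definition adjacency_matrix :: "('a, 'b) pre_digraph \<Rightarrow> 'a list \<Rightarrow> real mat" where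
  "adjacency_matrix G vs =
     mat (length vs) (length vs) (\<lambda>(i, j). if (vs ! i, vs ! j) \<in> arcs_ends G then 1 else 0)"

text \<open>
  The eigenvalues with multiplicity. The choice of enumeration is irrelevant
  (\<open>graph_spectrum_eq\<close>), and no eigenvalue is lost by taking only the real roots of the
  characteristic polynomial (\<open>size_graph_spectrum\<close>).
\<close>

definition graph_spectrum :: "('a, 'b) pre_digraph \<Rightarrow> real multiset" where
  "graph_spectrum G =
     proots (char_poly (adjacency_matrix G (SOME vs. distinct vs \<and> set vs = verts G)))"

text \<open>
  The \<open>i\<close>-th largest eigenvalue, meaningful for \<open>1 \<le> i \<le> card (verts G)\<close>.
\<close>

definition graph_eigenvalue :: "('a, 'b) pre_digraph \<Rightarrow> nat \<Rightarrow> real" where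
  "graph_eigenvalue G i = rev (sorted_list_of_multiset (graph_spectrum G)) ! (i - 1)"

lemma adjacency_matrix_carrier [simp]:
  "adjacency_matrix G vs \<in> carrier_mat (length vs) (length vs)"
  by (simp add: adjacency_matrix_def)

lemma similar_adjacency_matrix:
  assumes vs: "distinct vs" and ws: "distinct ws" and eq: "set vs = set ws"
  shows "similar_mat (adjacency_matrix G vs) (adjacency_matrix G ws)"
proof -
  define n where "n = length vs"
  have n': "length ws = n"
    using assms by (metis distinct_card n_def)
  have "\<exists>j<n. vs ! i = ws ! j" if "i < n" for i
    using that eq n' by (metis in_set_conv_nth n_def)
  then obtain s where s: "\<And>i. i < n \<Longrightarrow> s i < n \<and> vs ! i = ws ! s i"
    by metis
  have s_eq: "vs ! i = ws ! j \<longleftrightarrow> j = s i" if "i < n" "j < n" for i j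
    using s[OF that(1)] that n' ws by (auto simp: nth_eq_iff_index_eq)
  have inj: "inj_on s {..<n}"
    by (rule inj_onI) (metis lessThan_iff n_def nth_eq_iff_index_eq s vs)
  have "s ` {..<n} = {..<n}"
    using s by (intro endo_inj_surj inj) auto
  then have "\<exists>i<n. s i = j" if "j < n" for j
    using that by (metis imageE lessThan_iff)
  then obtain t where t: "\<And>j. j < n \<Longrightarrow> t j < n \<and> s (t j) = j"
    by metis
  have t_eq: "j = s i \<longleftrightarrow> i = t j" if "i < n" "j < n" for i j
    using that t inj by (metis inj_onD lessThan_iff)
  define P :: "real mat" where "P = mat n n (\<lambda>(i, j). if j = s i then 1 else 0)"
  define Q :: "real mat" where "Q = mat n n (\<lambda>(i, j). if i = s j then 1 else 0)"
  let ?A = "adjacency_matrix G vs" and ?B = "adjacency_matrix G ws"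
  have A: "?A \<in> carrier_mat n n" and B: "?B \<in> carrier_mat n n"
    and P: "P \<in> carrier_mat n n" and Q: "Q \<in> carrier_mat n n"
    using n' by (auto simp: n_def P_def Q_def adjacency_matrix_def)
  have PM: "(P * M) $$ (i, j) = M $$ (s i, j)"
    if "M \<in> carrier_mat n n" "i < n" "j < n" for M :: "real mat" and i j
  proof -
    have "(P * M) $$ (i, j) = (\<Sum>k = 0..<n. (if k = s i then 1 else 0) * M $$ (k, j))"
      using that by (auto simp: P_def scalar_prod_def intro!: sum.cong)
    also have "\<dots> = (\<Sum>k = 0..<n. if k = s i then M $$ (k, j) else 0)"
      by (rule sum.cong) auto
    also have "\<dots> = M $$ (s i, j)"
      using s[OF that(2)] by simp
    finally show ?thesis .
  qed
  have MQ: "(M * Q) $$ (i, j) = M $$ (i, s j)"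
    if "M \<in> carrier_mat n n" "i < n" "j < n" for M :: "real mat" and i j
  proof -
    have "(M * Q) $$ (i, j) = (\<Sum>k = 0..<n. M $$ (i, k) * (if k = s j then 1 else 0))"
      using that by (auto simp: Q_def scalar_prod_def intro!: sum.cong)
    also have "\<dots> = (\<Sum>k = 0..<n. if k = s j then M $$ (i, k) else 0)"
      by (rule sum.cong) auto
    also have "\<dots> = M $$ (i, s j)"
      using s[OF that(3)] by simp
    finally show ?thesis .
  qed
  have PQ: "P * Q = 1\<^sub>m n"
  proof (rule eq_matI)
    fix i j assume "i < dim_row (1\<^sub>m n :: real mat)" "j < dim_col (1\<^sub>m n :: real mat)"
    then show "(P * Q) $$ (i, j) = 1\<^sub>m n $$ (i, j)"
      using MQ[OF P, of i j] s[of j] inj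
      by (auto simp: P_def inj_on_def)
  qed (use P Q in auto)
  have QP: "Q * P = 1\<^sub>m n"
    using mat_mult_left_right_inverse[OF P Q PQ] .
  have "?A = P * ?B * Q"
  proof (rule eq_matI)
    fix i j assume "i < dim_row (P * ?B * Q)" "j < dim_col (P * ?B * Q)"
    then have ij: "i < n" "j < n"
      using P Q by auto
    have "(P * ?B * Q) $$ (i, j) = ?B $$ (s i, s j)"
      using MQ[of "P * ?B" i j] PM[OF B, of i "s j"] P B ij s by simp
    also have "\<dots> = ?A $$ (i, j)"
      using s[OF ij(1)] s[OF ij(2)] ij n' by (simp add: adjacency_matrix_def n_def)
    finally show "?A $$ (i, j) = (P * ?B * Q) $$ (i, j)" by simp
  qed (use A P Q in auto)
  then show ?thesis
    using A B P Q PQ QP by (intro similar_matI[of _ _ P Q n]) auto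
qed

lemma graph_spectrum_eq:
  assumes "distinct vs" "set vs = verts G"
  shows "graph_spectrum G = proots (char_poly (adjacency_matrix G vs))"
proof -
  have "distinct (SOME vs. distinct vs \<and> set vs = verts G) \<and>
        set (SOME vs. distinct vs \<and> set vs = verts G) = verts G"
    by (rule someI[of _ vs]) (use assms in simp)
  then have "char_poly (adjacency_matrix G (SOME vs. distinct vs \<and> set vs = verts G)) =
             char_poly (adjacency_matrix G vs)"
    using assms by (intro char_poly_similar similar_adjacency_matrix) auto
  then show ?thesis
    by (simp add: graph_spectrum_def)
qed

lemma real_symmetric_eigenvalue_real:
  fixes A :: "real mat"
  assumes A: "A \<in> carrier_mat n n" and sym: "\<And>i j. i < n \<Longrightarrow> j < n \<Longrightarrow> A $$ (i, j) = A $$ (j, i)"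
    and ev: "eigenvalue (map_mat complex_of_real A) a"
  shows "a \<in> \<real>"
proof -
  let ?C = "map_mat complex_of_real A"
  have C: "?C \<in> carrier_mat n n"
    using A by simp
  obtain v where v: "v \<in> carrier_vec n" "v \<noteq> 0\<^sub>v n" "?C *\<^sub>v v = a \<cdot>\<^sub>v v"
    using ev C unfolding eigenvalue_def eigenvector_def by auto
  have row: "(\<Sum>j<n. of_real (A $$ (i, j)) * v $ j) = a * v $ i" if "i < n" for i
  proof -
    have "(?C *\<^sub>v v) $ i = (\<Sum>j<n. of_real (A $$ (i, j)) * v $ j)"
      using that A v(1) by (auto simp: scalar_prod_def atLeast0LessThan intro!: sum.cong)
    then show ?thesis
      using v that by simp
  qed
  define N where "N = (\<Sum>i<n. v $ i * cnj (v $ i))"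
  define T where "T = (\<Sum>i<n. \<Sum>j<n. of_real (A $$ (i, j)) * v $ j * cnj (v $ i))"
  have T: "T = a * N"
    unfolding T_def N_def sum_distrib_left
    by (intro sum.cong refl) (simp add: row[symmetric] sum_distrib_right mult.assoc[symmetric])
  have "cnj T = (\<Sum>i<n. \<Sum>j<n. of_real (A $$ (i, j)) * cnj (v $ j) * v $ i)"
    by (simp add: T_def)
  also have "\<dots> = (\<Sum>j<n. \<Sum>i<n. of_real (A $$ (i, j)) * cnj (v $ j) * v $ i)"
    by (rule sum.swap)
  also have "\<dots> = T"
    unfolding T_def by (intro sum.cong refl) (simp add: sym)
  finally have cT: "cnj T = T" .
  have N: "N = of_real (\<Sum>i<n. (cmod (v $ i))\<^sup>2)"
    by (simp only: N_def of_real_sum complex_norm_square)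
  obtain i where "i < n" "v $ i \<noteq> 0"
    using v(1,2) by (metis carrier_vecD eq_vecI index_zero_vec)
  then have "(\<Sum>i<n. (cmod (v $ i))\<^sup>2) > 0"
    by (intro sum_pos2[of _ i]) auto
  then have N0: "N \<noteq> 0"
    unfolding N of_real_eq_0_iff by simp
  have "cnj a * N = a * N"
    using cT T N by (metis complex_cnj_complex_of_real complex_cnj_mult)
  with N0 have "cnj a = a" by simp
  then show ?thesis
    by (simp add: Reals_cnj_iff)
qed

lemma size_graph_spectrum:
  assumes "graph G"
  shows "size (graph_spectrum G) = card (verts G)"
proof -
  interpret graph G by fact
  interpret ph: map_poly_inj_idom_hom complex_of_real ..
  obtain vs where vs: "set vs = verts G" "distinct vs"
    using finite_distinct_list[OF finite_verts] by auto
  define n where "n = length vs"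
  let ?A = "adjacency_matrix G vs"
  let ?C = "map_mat complex_of_real ?A"
  have A: "?A \<in> carrier_mat n n" and C: "?C \<in> carrier_mat n n"
    by (simp_all add: n_def)
  have sym: "?A $$ (i, j) = ?A $$ (j, i)" if "i < n" "j < n" for i j
    using that sym_arcs by (auto simp: adjacency_matrix_def n_def symmetric_def dest: symD)
  obtain as where as: "char_poly ?C = (\<Prod>a\<leftarrow>as. [:- a, 1:])" "length as = n"
    using char_poly_factorized[OF C] by auto
  have real: "a = of_real (Re a)" if "a \<in> set as" for a
  proof -
    have "poly (char_poly ?C) a = 0"
      using that unfolding as(1) by (force simp: poly_prod_list prod_list_zero_iff)
    then have "eigenvalue ?C a"
      using eigenvalue_root_char_poly[OF C] by simp
    then show ?thesis
      using real_symmetric_eigenvalue_real[OF A sym] by simp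
  qed
  have "map_poly complex_of_real (char_poly ?A) = char_poly ?C"
    by (rule of_real_hom.char_poly_hom[OF A, symmetric])
  also have "\<dots> = (\<Prod>a\<leftarrow>as. map_poly complex_of_real [:- Re a, 1:])"
    unfolding as(1) using real by (intro arg_cong[of _ _ prod_list] map_cong) auto
  also have "\<dots> = map_poly complex_of_real (\<Prod>a\<leftarrow>as. [:- Re a, 1:])"
    by (simp only: ph.hom_prod_list map_map o_def)
  finally have "char_poly ?A = (\<Prod>a\<leftarrow>as. [:- Re a, 1:])"
    by (simp only: ph.eq_iff)
  also have "\<dots> = (\<Prod>p\<leftarrow>map (\<lambda>a. [:- Re a, 1:]) as. p)"
    by simp
  finally have "proots (char_poly ?A) = (\<Sum>p\<leftarrow>map (\<lambda>a. [:- Re a, 1:]) as. proots p)"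
    by (simp only:) (rule proots_prod_list, auto)
  also have "size \<dots> = length as"
    by (induction as) auto
  finally show ?thesis
    using graph_spectrum_eq[OF vs(2,1)] as(2) vs by (simp add: n_def distinct_card[symmetric])
qed

end

theory Submission
  imports Defs "Jordan_Normal_Form.Schur_Decomposition" "Jordan_Normal_Form.Spectral_Radius"
begin

text \<open>
  The bound on the order is the Ramsey bound for a clique on \<open>k + 1\<close> or an independent set on \<open>k\<close>
  vertices (\<open>ramsey_binomial\<close>), and each of these two induced subgraphs forces both inequalities.

  Let \<open>A\<close> be the adjacency matrix, and consider vectors \<open>x\<close> supported on the subgraph. For an
  independent set, the form \<open>x \<bullet> A x\<close> vanishes on this space of dimension \<open>k\<close>, so at least \<open>k\<close>
  eigenvalues are \<open>\<ge> 0\<close> and at least \<open>k\<close> are \<open>\<le> 0\<close>. For a clique, the form is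
  \<open>(\<Sum>i. x i)\<^sup>2 - (\<Sum>i. (x i)\<^sup>2)\<close> (\<open>quadratic_form_clique\<close>), which is at least \<open>- 1\<close> times the
  squared norm on the whole space of dimension \<open>k + 1\<close>, and at most \<open>0\<close> on the hyperplane of
  vectors with coordinate sum \<open>0\<close>, which has dimension \<open>k\<close>. This hyperplane is the reason why a
  clique must have one vertex more than an independent set. In both cases at least \<open>k\<close>
  eigenvalues are \<open>\<ge> - 1\<close> and at least \<open>k\<close> are \<open>\<le> 0\<close>, which is the claim about the \<open>k\<close>-th
  largest and the \<open>k\<close>-th smallest one.

  The passage from a form that is bounded on a subspace to a number of eigenvalues is the easy half
  of the Courant--Fischer principle (\<open>card_diagonal_entries_ge\<close>, \<open>card_diagonal_entries_le\<close>). It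
  rests on an orthonormal eigenbasis (\<open>real_symmetric_spectral\<close>) whose eigenvalues are the roots
  of the characteristic polynomial with multiplicity
  (\<open>real_symmetric_quadratic_form_diagonal\<close>).
\<close>

section \<open>Ramsey's theorem for graphs with the binomial bound\<close>

text \<open>
  The classical induction: fix a vertex \<open>v\<close>. By Pascal's rule, either the neighbours or the
  non-neighbours of \<open>v\<close> are numerous enough for the induction hypothesis with one of the two sizes
  lowered, and \<open>v\<close> extends the homogeneous set found there. The sizes are \<open>Suc s\<close> and
  \<open>Suc t\<close>, so that the binomial coefficient can be written without predecessors.
\<close>

lemma ramsey_binomial:
  fixes E :: "'v \<Rightarrow> 'v \<Rightarrow> bool"
  assumes "symp E" "finite V" "card V \<ge> (s + t) choose s"
  shows "(\<exists>S\<subseteq>V. card S = Suc s \<and> pairwise E S) \<or>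
         (\<exists>S\<subseteq>V. card S = Suc t \<and> pairwise (\<lambda>v w. \<not> E v w) S)"
  using assms(2,3)
proof (induction "s + t" arbitrary: s t V)
  case 0
  then obtain v where "v \<in> V"
    by (cases "V = {}") auto
  then show ?case
    using 0 by (intro disjI1 exI[of _ "{v}"]) auto
next
  case (Suc m)
  have "(s + t) choose s > 0"
    by simp
  then have "V \<noteq> {}"
    using Suc.prems by auto
  then obtain v where v: "v \<in> V"
    by blast
  show ?case
  proof (cases "s = 0 \<or> t = 0")
    case True
    with v show ?thesis
      by (elim disjE) (auto intro!: exI[of _ "{v}"])
  next
    case False
    define N where "N = {w \<in> V - {v}. E v w}"
    define M where "M = {w \<in> V - {v}. \<not> E v w}"
    obtain s' t' where st: "s = Suc s'" "t = Suc t'"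
      using False by (metis not0_implies_Suc)
    have fin: "finite N" "finite M"
      using Suc.prems by (auto simp: N_def M_def)
    have "card N + card M = card (N \<union> M)"
      using fin by (intro card_Un_disjoint[symmetric]) (auto simp: N_def M_def)
    also have "N \<union> M = V - {v}"
      by (auto simp: N_def M_def)
    finally have "Suc (card N + card M) = card V"
      using v Suc.prems by (metis card_Suc_Diff1)
    moreover have "(s + t) choose s = ((s' + t) choose s') + ((s + t') choose s)"
      by (simp add: st)
    ultimately consider "card N \<ge> (s' + t) choose s'" | "card M \<ge> (s + t') choose s"
      using Suc.prems(2) by linarith
    then show ?thesis
    proof cases
      case 1
      have "m = s' + t"
        using Suc.hyps(2) st by simp
      from Suc.hyps(1)[OF this fin(1) 1] show ?thesis
      proof (elim disjE exE conjE)
        fix S assume S: "S \<subseteq> N" "card S = Suc s'" "pairwise E S"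
        have "pairwise E (insert v S)"
          using S \<open>symp E\<close> by (auto simp: pairwise_insert N_def dest: sympD)
        moreover have "card (insert v S) = Suc s"
          using S fin(1) finite_subset[OF S(1)] by (subst card_insert_disjoint) (auto simp: N_def st)
        ultimately show ?thesis
          using S v by (intro disjI1 exI[of _ "insert v S"]) (auto simp: N_def)
      next
        fix S assume "S \<subseteq> N" "card S = Suc t" "pairwise (\<lambda>v w. \<not> E v w) S"
        then show ?thesis
          by (intro disjI2 exI[of _ S]) (auto simp: N_def)
      qed
    next
      case 2
      have "m = s + t'"
        using Suc.hyps(2) st by simp
      from Suc.hyps(1)[OF this fin(2) 2] show ?thesis
      proof (elim disjE exE conjE)
        fix S assume S: "S \<subseteq> M" "card S = Suc t'" "pairwise (\<lambda>v w. \<not> E v w) S"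
        have "pairwise (\<lambda>v w. \<not> E v w) (insert v S)"
          using S \<open>symp E\<close> by (auto simp: pairwise_insert M_def dest: sympD)
        moreover have "card (insert v S) = Suc t"
          using S fin(2) finite_subset[OF S(1)] by (subst card_insert_disjoint) (auto simp: M_def st)
        ultimately show ?thesis
          using S v by (intro disjI2 exI[of _ "insert v S"]) (auto simp: M_def)
      next
        fix S assume "S \<subseteq> M" "card S = Suc s" "pairwise E S"
        then show ?thesis
          by (intro disjI1 exI[of _ S]) (auto simp: M_def)
      qed
    qed
  qed
qed

section \<open>The spectral theorem for real symmetric matrices\<close>

text \<open>
  Over the complex numbers an eigenvalue exists; for a symmetric real matrix it is real, hence a
  root of the real characteristic polynomial.
\<close>

lemma symmetric_real_mat_eigenvalue_exists:
  fixes A :: "real mat"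
  assumes A: "A \<in> carrier_mat n n" and sym: "transpose_mat A = A" and n: "n > 0"
  obtains e where "eigenvalue A e"
proof -
  let ?C = "map_mat complex_of_real A"
  have C: "?C \<in> carrier_mat n n"
    using A by simp
  obtain a where a: "eigenvalue ?C a"
    using spectrum_non_empty[OF C n] by (auto simp: spectrum_def)
  have "A $$ (i, j) = A $$ (j, i)" if "i < n" "j < n" for i j
    using that A arg_cong[OF sym, of "\<lambda>M. M $$ (i, j)"] by simp
  then have "a \<in> \<real>"
    using real_symmetric_eigenvalue_real[OF A _ a] by blast
  then obtain r where r: "a = complex_of_real r"
    by (auto elim: Reals_cases)
  have "poly (char_poly ?C) a = 0"
    using a eigenvalue_root_char_poly[OF C] by simp
  then have "poly (char_poly A) r = 0"
    unfolding of_real_hom.char_poly_hom[OF A] r by simp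
  then show thesis
    using that eigenvalue_root_char_poly[OF A] by blast
qed

text \<open>
  Gram--Schmidt applied to a basis that starts with \<open>v\<close> yields pairwise orthogonal vectors of
  arbitrary lengths. They are normalised so that the inverse of \<open>W\<close> is its transpose: the
  conjugate of a symmetric matrix by \<open>W\<close> is then symmetric again, which the induction below needs.
\<close>

lemma orthogonal_mat_with_first_column:
  fixes v :: "real vec"
  assumes v: "v \<in> carrier_vec n" "v \<noteq> 0\<^sub>v n"
  obtains W c where "W \<in> carrier_mat n n" "transpose_mat W * W = 1\<^sub>m n" "col W 0 = c \<cdot>\<^sub>v v"
proof -
  interpret cof_vec_space n "TYPE(real)" .
  define b where "b = basis_completion v"
  define ws where "ws = gram_schmidt n b"
  from basis_completion[OF v, folded b_def]
  have dist_b: "distinct b" and indep: "\<not> lin_dep (set b)" and b: "set b \<subseteq> carrier_vec n"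
    and hdb: "hd b = v" and len_b: "length b = n"
    by auto
  have n: "n > 0"
    using v by (cases n) auto
  obtain vs where bv: "b = v # vs"
    using hdb len_b n by (cases b) auto
  from gram_schmidt_result[OF b dist_b indep refl, folded ws_def]
  have ws: "set ws \<subseteq> carrier_vec n" "corthogonal ws" "length ws = n"
    by (auto simp: len_b)
  have hdws: "ws ! 0 = v"
    using gram_schmidt_hd[OF v(1), of vs, folded bv] ws(3) n
    by (simp add: ws_def hd_conv_nth flip: length_greater_0_conv)
  have wi: "ws ! i \<in> carrier_vec n" if "i < n" for i
    using ws that by (auto simp: subset_iff)
  have conj: "conjugate w = w" for w :: "real vec"
    by (rule eq_vecI) auto
  have orth: "ws ! i \<bullet> ws ! j = 0 \<longleftrightarrow> i \<noteq> j" if "i < n" "j < n" for i j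
    using corthogonalD[OF ws(2), of i j] that ws(3) by (simp add: conj)
  define r where "r i = 1 / sqrt (ws ! i \<bullet> ws ! i)" for i
  define W where "W = mat_of_cols n (map (\<lambda>i. r i \<cdot>\<^sub>v ws ! i) [0..<n])"
  have W: "W \<in> carrier_mat n n"
    unfolding W_def using mat_of_cols_carrier(1)[of n "map (\<lambda>i. r i \<cdot>\<^sub>v ws ! i) [0..<n]"] by simp
  have colW: "col W i = r i \<cdot>\<^sub>v ws ! i" if "i < n" for i
    using that wi[OF that] unfolding W_def by (subst col_mat_of_cols) auto
  have "transpose_mat W * W = 1\<^sub>m n"
  proof (rule eq_matI)
    fix i j assume "i < dim_row (1\<^sub>m n :: real mat)" "j < dim_col (1\<^sub>m n :: real mat)"
    then have ij: "i < n" "j < n"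
      by auto
    have "(transpose_mat W * W) $$ (i, j) = r i * (r j * (ws ! i \<bullet> ws ! j))"
      using ij W wi[OF ij(1)] wi[OF ij(2)] by (simp add: colW)
    also have "\<dots> = 1\<^sub>m n $$ (i, j)"
    proof (cases "i = j")
      case True
      have "ws ! i \<bullet> ws ! i \<ge> 0"
        by (auto simp: scalar_prod_def intro: sum_nonneg)
      moreover have "ws ! i \<bullet> ws ! i \<noteq> 0"
        using orth[of i i] ij by simp
      ultimately have "ws ! i \<bullet> ws ! i > 0"
        by simp
      then show ?thesis
        using True ij by (simp add: r_def)
    next
      case False
      then show ?thesis
        using orth[of i j] ij by simp
    qed
    finally show "(transpose_mat W * W) $$ (i, j) = 1\<^sub>m n $$ (i, j)" .
  qed (use W in auto)
  then show thesis
    using that[OF W] colW[OF n] hdws by simp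
qed

lemma symmetric_conjugation:
  fixes A :: "'a :: comm_ring_1 mat"
  assumes "A \<in> carrier_mat n n" "W \<in> carrier_mat n n" "transpose_mat A = A"
  shows "transpose_mat (transpose_mat W * A * W) = transpose_mat W * A * W"
  using assms by (simp add: transpose_mult[of _ n n _ n] assoc_mult_mat[of _ n n _ n _ n])

text \<open>
  Induction on the size. In an orthonormal basis whose first vector is an eigenvector, the first
  column of the matrix vanishes below the diagonal; since the matrix stays symmetric, so does the
  first row, and what remains is a smaller symmetric block.
\<close>

theorem real_symmetric_spectral:
  fixes A :: "real mat"
  assumes "A \<in> carrier_mat n n" "transpose_mat A = A"
  shows "\<exists>P \<in> carrier_mat n n. transpose_mat P * P = 1\<^sub>m n \<and> diagonal_mat (transpose_mat P * A * P)"
  using assms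
proof (induction n arbitrary: A)
  case 0
  then show ?case
    by (intro bexI[of _ "1\<^sub>m 0"]) (auto simp: diagonal_mat_def)
next
  case (Suc m)
  let ?n = "Suc m"
  note A = Suc.prems(1)
  obtain e where "eigenvalue A e"
    using symmetric_real_mat_eigenvalue_exists[OF Suc.prems] by blast
  then obtain v where v: "v \<in> carrier_vec ?n" "v \<noteq> 0\<^sub>v ?n" "A *\<^sub>v v = e \<cdot>\<^sub>v v"
    using A unfolding eigenvalue_def eigenvector_def by auto
  obtain W c where W: "W \<in> carrier_mat ?n ?n" and WW: "transpose_mat W * W = 1\<^sub>m ?n"
    and W0: "col W 0 = c \<cdot>\<^sub>v v"
    using orthogonal_mat_with_first_column[OF v(1,2)] by blast
  define A' where "A' = transpose_mat W * A * W"
  have A': "A' \<in> carrier_mat ?n ?n"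
    using A W by (simp add: A'_def)
  have symA': "transpose_mat A' = A'"
    unfolding A'_def using A W Suc.prems(2) by (rule symmetric_conjugation)
  have A'sym: "A' $$ (i, j) = A' $$ (j, i)" if "i < ?n" "j < ?n" for i j
    using that A' arg_cong[OF symA', of "\<lambda>M. M $$ (i, j)"] by simp
  have A'0: "A' $$ (i, 0) = (if i = 0 then e else 0)" if i: "i < ?n" for i
  proof -
    have "A' = transpose_mat W * (A * W)"
      using A W by (simp add: A'_def assoc_mult_mat[of _ ?n ?n _ ?n _ ?n])
    then have "A' $$ (i, 0) = col W i \<bullet> col (A * W) 0"
      using i A W by simp
    also have "col (A * W) 0 = A *\<^sub>v col W 0"
      using A W by (intro col_mult2[of _ ?n ?n _ ?n]) auto
    also have "\<dots> = e \<cdot>\<^sub>v col W 0"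
      using A v by (simp add: W0 mult_mat_vec[of _ ?n ?n] smult_smult_assoc mult.commute)
    also have "col W i \<bullet> \<dots> = e * (transpose_mat W * W) $$ (i, 0)"
      using i W by simp
    also have "\<dots> = (if i = 0 then e else 0)"
      using i by (simp add: WW)
    finally show ?thesis .
  qed
  define B where "B = mat m m (\<lambda>(i, j). A' $$ (Suc i, Suc j))"
  have B: "B \<in> carrier_mat m m"
    by (simp add: B_def)
  have "transpose_mat B = B"
    by (rule eq_matI) (auto simp: B_def A'sym)
  from Suc.IH[OF B this] obtain P where P: "P \<in> carrier_mat m m"
    and PP: "transpose_mat P * P = 1\<^sub>m m" and diag: "diagonal_mat (transpose_mat P * B * P)"
    by blast
  define E :: "real mat" where "E = mat 1 1 (\<lambda>_. e)"
  have E: "E \<in> carrier_mat 1 1"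
    by (simp add: E_def)
  have blockA': "A' = four_block_mat E (0\<^sub>m 1 m) (0\<^sub>m m 1) B"
  proof (rule eq_matI)
    fix i j
    assume "i < dim_row (four_block_mat E (0\<^sub>m 1 m) (0\<^sub>m m 1) B)"
      "j < dim_col (four_block_mat E (0\<^sub>m 1 m) (0\<^sub>m m 1) B)"
    then have "i < ?n" "j < ?n"
      using E B by auto
    then show "A' $$ (i, j) = four_block_mat E (0\<^sub>m 1 m) (0\<^sub>m m 1) B $$ (i, j)"
      using A'0[of i] A'0[of j] A'sym[of i j] E B
      by (cases i; cases j) (auto simp: E_def B_def)
  qed (use A' E B in auto)
  define R where "R = four_block_mat (1\<^sub>m 1) (0\<^sub>m 1 m) (0\<^sub>m m 1) P"
  have R: "R \<in> carrier_mat ?n ?n"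
    using four_block_carrier_mat[of "1\<^sub>m 1" 1 1 P m m] P by (simp add: R_def)
  have Rt: "transpose_mat R = four_block_mat (1\<^sub>m 1) (0\<^sub>m 1 m) (0\<^sub>m m 1) (transpose_mat P)"
    unfolding R_def using P by (subst transpose_four_block_mat[of _ 1 1 _ m _ m]) auto
  have RR: "transpose_mat R * R = 1\<^sub>m ?n"
    unfolding Rt unfolding R_def using P PP
    by (subst mult_four_block_mat[of _ 1 1 _ m _ m _ _ 1 _ m]) (auto intro!: eq_matI)
  have RAR: "transpose_mat R * A' * R =
      four_block_mat E (0\<^sub>m 1 m) (0\<^sub>m m 1) (transpose_mat P * B * P)"
    unfolding Rt blockA' unfolding R_def using P B E
    by (simp add: mult_four_block_mat[of _ 1 1 _ m _ m _ _ 1 _ m])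
  have WR: "W * R \<in> carrier_mat ?n ?n"
    using W R by simp
  have t: "transpose_mat (W * R) = transpose_mat R * transpose_mat W"
    using W R by (rule transpose_mult)
  have "transpose_mat (W * R) * (W * R) = transpose_mat R * (transpose_mat W * W) * R"
    unfolding t using W R by (simp add: assoc_mult_mat[of _ ?n ?n _ ?n _ ?n])
  also have "\<dots> = 1\<^sub>m ?n"
    using R by (simp add: WW RR)
  finally have orth: "transpose_mat (W * R) * (W * R) = 1\<^sub>m ?n" .
  have "transpose_mat (W * R) * A * (W * R) = transpose_mat R * A' * R"
    unfolding t A'_def using W R A by (simp add: assoc_mult_mat[of _ ?n ?n _ ?n _ ?n])
  moreover have "diagonal_mat (transpose_mat R * A' * R)"
    unfolding RAR using diag P B E by (auto simp: diagonal_mat_def)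
  ultimately show ?case
    using WR orth by auto
qed

text \<open>
  The spectral theorem in the form used below: the functions \<open>q l\<close> are the orthonormal
  eigenvectors, so that \<open>\<Sum>i<n. q l i * x i\<close> is the \<open>l\<close>-th coordinate of \<open>x\<close> in the eigenbasis. Plain functions
  replace vectors, which makes it easy to restrict \<open>x\<close> to a set of vertices.
\<close>

lemma real_symmetric_quadratic_form_diagonal:
  fixes A :: "real mat"
  assumes A: "A \<in> carrier_mat n n" and sym: "transpose_mat A = A"
  obtains d :: "nat \<Rightarrow> real" and q :: "nat \<Rightarrow> nat \<Rightarrow> real"
  where "proots (char_poly A) = image_mset d (mset_set {..<n})"
    and "\<And>x. (\<Sum>i<n. \<Sum>j<n. A $$ (i, j) * x i * x j) = (\<Sum>l<n. d l * (\<Sum>i<n. q l i * x i)\<^sup>2)"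
    and "\<And>x. (\<Sum>i<n. (x i)\<^sup>2) = (\<Sum>l<n. (\<Sum>i<n. q l i * x i)\<^sup>2)"
proof -
  obtain P where P: "P \<in> carrier_mat n n" and PP: "transpose_mat P * P = 1\<^sub>m n"
    and diag: "diagonal_mat (transpose_mat P * A * P)"
    using real_symmetric_spectral[OF assms] by blast
  let ?Q = "transpose_mat P"
  define D where "D = ?Q * A * P"
  have Q: "?Q \<in> carrier_mat n n" and D: "D \<in> carrier_mat n n"
    using P A by (auto simp: D_def)
  have PQ: "P * ?Q = 1\<^sub>m n"
    using mat_mult_left_right_inverse[OF Q P PP] .
  have "P * D * ?Q = (P * ?Q) * A * (P * ?Q)"
    unfolding D_def using P Q A by (simp add: assoc_mult_mat[of _ n n _ n _ n])
  then have AD: "A = P * D * ?Q"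
    using A by (simp add: PQ)
  define d where "d l = D $$ (l, l)" for l
  define q where "q l i = P $$ (i, l)" for l i
  have Dd: "D $$ (i, j) = (if i = j then d i else 0)" if "i < n" "j < n" for i j
    using diag that D by (auto simp: d_def diagonal_mat_def D_def[symmetric])
  have "char_poly A = char_poly D"
    using A D P Q PQ PP AD by (intro char_poly_similar similar_matI[of _ _ P ?Q n]) auto
  also have "\<dots> = (\<Prod>a\<leftarrow>diag_mat D. [:- a, 1:])"
    using D Dd by (intro char_poly_upper_triangular) auto
  also have "diag_mat D = map d [0..<n]"
    using D by (simp add: diag_mat_def d_def)
  finally have cp: "char_poly A = (\<Prod>p\<leftarrow>map (\<lambda>l. [:- d l, 1:]) [0..<n]. p)"
    by (simp add: o_def)
  have "proots (char_poly A) = (\<Sum>p\<leftarrow>map (\<lambda>l. [:- d l, 1:]) [0..<n]. proots p)"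
    unfolding cp by (rule proots_prod_list) auto
  also have "\<dots> = image_mset d (mset [0..<n])"
    by (induction n) auto
  finally have "proots (char_poly A) = image_mset d (mset_set {..<n})"
    by (simp add: atLeast0LessThan)
  moreover have "(\<Sum>i<n. \<Sum>j<n. A $$ (i, j) * x i * x j) = (\<Sum>l<n. d l * (\<Sum>i<n. q l i * x i)\<^sup>2)"
    for x :: "nat \<Rightarrow> real"
  proof -
    have a: "A $$ (i, j) = (\<Sum>l<n. d l * q l i * q l j)" if ij: "i < n" "j < n" for i j
    proof -
      have PD: "(P * D) $$ (i, l) = d l * q l i" if "l < n" for l
      proof -
        have "(P * D) $$ (i, l) = (\<Sum>h<n. P $$ (i, h) * D $$ (h, l))"
          using that ij P D by (auto simp: scalar_prod_def atLeast0LessThan intro!: sum.cong)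
        also have "\<dots> = (\<Sum>h<n. if h = l then P $$ (i, h) * d h else 0)"
          using that by (intro sum.cong) (auto simp: Dd)
        finally show ?thesis
          using that by (simp add: q_def)
      qed
      have "A $$ (i, j) = row (P * D) i \<bullet> col ?Q j"
        unfolding AD using ij P D by (intro index_mult_mat(1)) auto
      also have "\<dots> = (\<Sum>l<n. (P * D) $$ (i, l) * ?Q $$ (l, j))"
        unfolding scalar_prod_def using ij P D
        by (intro sum.cong) (auto simp: atLeast0LessThan)
      also have "\<dots> = (\<Sum>l<n. d l * q l i * q l j)"
        using ij P PD by (intro sum.cong) (auto simp: q_def)
      finally show ?thesis .
    qed
    have "(\<Sum>i<n. \<Sum>j<n. A $$ (i, j) * x i * x j) =
        (\<Sum>i<n. \<Sum>j<n. \<Sum>l<n. d l * ((q l i * x i) * (q l j * x j)))"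
      by (intro sum.cong refl) (simp add: a sum_distrib_right sum_distrib_left mult_ac)
    also have "\<dots> = (\<Sum>i<n. \<Sum>l<n. \<Sum>j<n. d l * ((q l i * x i) * (q l j * x j)))"
      by (intro sum.cong refl sum.swap)
    also have "\<dots> = (\<Sum>l<n. \<Sum>i<n. \<Sum>j<n. d l * ((q l i * x i) * (q l j * x j)))"
      by (rule sum.swap)
    also have "\<dots> = (\<Sum>l<n. d l * (\<Sum>i<n. q l i * x i)\<^sup>2)"
      unfolding power2_eq_square sum_product by (simp only: sum_distrib_left)
    finally show ?thesis .
  qed
  moreover have "(\<Sum>i<n. (x i)\<^sup>2) = (\<Sum>l<n. (\<Sum>i<n. q l i * x i)\<^sup>2)" for x :: "nat \<Rightarrow> real"
  proof -
    have delta: "(\<Sum>l<n. q l i * q l j) = (if i = j then 1 else 0)" if ij: "i < n" "j < n" for i j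
    proof -
      have "(\<Sum>l<n. q l i * q l j) = (P * ?Q) $$ (i, j)"
        using ij P by (auto simp: q_def scalar_prod_def atLeast0LessThan intro!: sum.cong)
      then show ?thesis
        using ij by (simp add: PQ)
    qed
    have "(\<Sum>l<n. (\<Sum>i<n. q l i * x i)\<^sup>2) = (\<Sum>l<n. \<Sum>i<n. \<Sum>j<n. (q l i * x i) * (q l j * x j))"
      by (simp add: power2_eq_square sum_product)
    also have "\<dots> = (\<Sum>i<n. \<Sum>l<n. \<Sum>j<n. (q l i * x i) * (q l j * x j))"
      by (rule sum.swap)
    also have "\<dots> = (\<Sum>i<n. \<Sum>j<n. \<Sum>l<n. (q l i * x i) * (q l j * x j))"
      by (intro sum.cong refl sum.swap)
    also have "\<dots> = (\<Sum>i<n. \<Sum>j<n. x i * x j * (\<Sum>l<n. q l i * q l j))"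
      by (simp add: sum_distrib_left mult_ac)
    also have "\<dots> = (\<Sum>i<n. \<Sum>j<n. if i = j then (x i)\<^sup>2 else 0)"
      by (intro sum.cong refl) (simp add: delta power2_eq_square)
    also have "\<dots> = (\<Sum>i<n. (x i)\<^sup>2)"
      by simp
    finally show ?thesis by simp
  qed
  ultimately show thesis
    using that by blast
qed

section \<open>Counting eigenvalues by a subspace\<close>

text \<open>
  Gaussian elimination: an equation in which some unknown \<open>x s\<close> really occurs is solved for
  \<open>x s\<close> and substituted in the others, which removes one equation and one unknown.
\<close>

lemma homogeneous_system_nontrivial_solution:
  fixes g :: "'j \<Rightarrow> 'i \<Rightarrow> 'a :: field"
  assumes "finite J" "finite S" "card J < card S"
  shows "\<exists>x. (\<exists>i\<in>S. x i \<noteq> 0) \<and> (\<forall>i. i \<notin> S \<longrightarrow> x i = 0) \<and> (\<forall>j\<in>J. (\<Sum>i\<in>S. g j i * x i) = 0)"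
  using assms
proof (induction J arbitrary: g S)
  case empty
  then obtain s where "s \<in> S"
    by (cases "S = {}") auto
  then show ?case
    by (intro exI[of _ "\<lambda>i. if i = s then 1 else 0"]) auto
next
  case (insert f J)
  show ?case
  proof (cases "\<forall>i\<in>S. g f i = 0")
    case True
    have "card J < card S"
      using insert by simp
    from insert.IH[OF insert.prems(1) this, of g] show ?thesis
      using True by (auto simp: ball_Un)
  next
    case False
    then obtain s where s: "s \<in> S" "g f s \<noteq> 0"
      by blast
    let ?S = "S - {s}"
    have "finite ?S" "card J < card ?S"
      using insert s by auto
    from insert.IH[OF this, of "\<lambda>j i. g j i - g j s / g f s * g f i"]
    obtain x where x: "\<exists>i\<in>?S. x i \<noteq> 0" "\<And>i. i \<notin> ?S \<Longrightarrow> x i = 0"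
      "\<And>j. j \<in> J \<Longrightarrow> (\<Sum>i\<in>?S. (g j i - g j s / g f s * g f i) * x i) = 0"
      by auto
    define y where "y = x(s := - (\<Sum>i\<in>?S. g f i * x i) / g f s)"
    have y: "(\<Sum>i\<in>S. h i * y i) = (\<Sum>i\<in>?S. (h i - h s / g f s * g f i) * x i)" for h
    proof -
      have "(\<Sum>i\<in>S. h i * y i) = h s * y s + (\<Sum>i\<in>?S. h i * y i)"
        using insert.prems(1) s(1) by (rule sum.remove)
      also have "(\<Sum>i\<in>?S. h i * y i) = (\<Sum>i\<in>?S. h i * x i)"
        by (intro sum.cong) (auto simp: y_def)
      also have "h s * y s = - (\<Sum>i\<in>?S. h s / g f s * g f i * x i)"
        by (simp add: y_def sum_distrib_left sum_divide_distrib mult_ac)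
      finally show ?thesis
        by (simp add: sum_subtractf left_diff_distrib)
    qed
    have "(\<Sum>i\<in>S. g j i * y i) = 0" if "j \<in> insert f J" for j
      using that x(3) s(2) by (auto simp: y)
    moreover have "\<exists>i\<in>S. y i \<noteq> 0"
      using x(1) by (auto simp: y_def)
    moreover have "\<forall>i. i \<notin> S \<longrightarrow> y i = 0"
      using x(2) s(1) by (auto simp: y_def)
    ultimately show ?thesis
      by blast
  qed
qed

text \<open>
  One half of the Courant--Fischer principle, with \<open>d l\<close> the eigenvalues and \<open>q l\<close> the eigenvectors
  of the form. The vectors supported on \<open>S\<close> that satisfy the linear conditions in \<open>F\<close> form a space of dimension at least \<open>card S - card F\<close>. If fewer than that many
  eigenvalues were \<open>\<ge> c\<close>, this space would contain a nonzero vector orthogonal to all their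
  eigenvectors; it would be a combination of eigenvectors with eigenvalues \<open>< c\<close> only, and the
  form would be strictly below \<open>c\<close> times the squared norm at it.
\<close>

lemma card_diagonal_entries_ge:
  fixes a q :: "nat \<Rightarrow> nat \<Rightarrow> real" and d :: "nat \<Rightarrow> real"
  assumes form: "\<And>x. (\<Sum>i<n. \<Sum>j<n. a i j * x i * x j) = (\<Sum>l<n. d l * (\<Sum>i<n. q l i * x i)\<^sup>2)"
    and norm: "\<And>x. (\<Sum>i<n. (x i)\<^sup>2) = (\<Sum>l<n. (\<Sum>i<n. q l i * x i)\<^sup>2)"
    and S: "S \<subseteq> {..<n}" and F: "finite F"
    and lower: "\<And>x. \<forall>i. i \<notin> S \<longrightarrow> x i = 0 \<Longrightarrow> \<forall>f\<in>F. (\<Sum>i\<in>S. f i * x i) = 0 \<Longrightarrow>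
      (\<Sum>i\<in>S. \<Sum>j\<in>S. a i j * x i * x j) \<ge> c * (\<Sum>i\<in>S. (x i)\<^sup>2)"
  shows "card S \<le> card {l. l < n \<and> d l \<ge> c} + card F"
proof (rule ccontr)
  assume less: "\<not> ?thesis"
  let ?L = "{l. l < n \<and> d l \<ge> c}"
  have "card (F \<union> q ` ?L) \<le> card F + card (q ` ?L)"
    by (rule card_Un_le)
  also have "\<dots> \<le> card F + card ?L"
    by (intro add_left_mono card_image_le) auto
  finally have "card (F \<union> q ` ?L) < card S"
    using less by simp
  from homogeneous_system_nontrivial_solution[OF _ _ this, of "\<lambda>f. f"]
  obtain x where x: "\<exists>i\<in>S. x i \<noteq> 0" "\<forall>i. i \<notin> S \<longrightarrow> x i = 0"
    "\<forall>f\<in>F \<union> q ` ?L. (\<Sum>i\<in>S. f i * x i) = 0"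
    using F finite_subset[OF S] by auto
  have restrict: "(\<Sum>i<n. h i) = (\<Sum>i\<in>S. h i)" if "\<And>i. i \<notin> S \<Longrightarrow> h i = 0" for h :: "nat \<Rightarrow> real"
    using S that by (intro sum.mono_neutral_right) auto
  define y where "y l = (\<Sum>i<n. q l i * x i)" for l
  have y0: "y l = 0" if "l < n" "d l \<ge> c" for l
    using x(2,3) that by (auto simp: y_def restrict)
  have "(\<Sum>i<n. (x i)\<^sup>2) > 0"
  proof -
    obtain i where "i \<in> S" "x i \<noteq> 0"
      using x(1) by blast
    then show ?thesis
      using S by (intro sum_pos2[of _ i]) auto
  qed
  then have "(\<Sum>l<n. (y l)\<^sup>2) \<noteq> 0"
    using norm[of x] by (simp add: y_def)
  then obtain l where l: "l < n" "y l \<noteq> 0"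
    by (metis (mono_tags, lifting) lessThan_iff sum.neutral zero_power2)
  have "(\<Sum>l<n. d l * (y l)\<^sup>2) < (\<Sum>l<n. c * (y l)\<^sup>2)"
  proof (rule sum_strict_mono_ex1)
    show "\<forall>l\<in>{..<n}. d l * (y l)\<^sup>2 \<le> c * (y l)\<^sup>2"
    proof
      fix l assume "l \<in> {..<n}"
      then show "d l * (y l)\<^sup>2 \<le> c * (y l)\<^sup>2"
        using y0[of l] by (cases "d l \<ge> c") (auto intro: mult_right_mono)
    qed
    show "\<exists>l\<in>{..<n}. d l * (y l)\<^sup>2 < c * (y l)\<^sup>2"
      using l y0[of l] by (intro bexI[of _ l]) (auto simp: not_le[symmetric] intro!: mult_strict_right_mono)
  qed simp
  then have "(\<Sum>i<n. \<Sum>j<n. a i j * x i * x j) < c * (\<Sum>i<n. (x i)\<^sup>2)"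
    using form[of x] norm[of x] by (simp add: y_def sum_distrib_left)
  also have "(\<Sum>i<n. \<Sum>j<n. a i j * x i * x j) = (\<Sum>i\<in>S. \<Sum>j\<in>S. a i j * x i * x j)"
    using x(2) by (simp add: restrict)
  also have "(\<Sum>i<n. (x i)\<^sup>2) = (\<Sum>i\<in>S. (x i)\<^sup>2)"
    using x(2) by (simp add: restrict)
  finally show False
    using lower[of x] x(2,3) by auto
qed

lemma card_diagonal_entries_le:
  fixes a q :: "nat \<Rightarrow> nat \<Rightarrow> real" and d :: "nat \<Rightarrow> real"
  assumes form: "\<And>x. (\<Sum>i<n. \<Sum>j<n. a i j * x i * x j) = (\<Sum>l<n. d l * (\<Sum>i<n. q l i * x i)\<^sup>2)"
    and norm: "\<And>x. (\<Sum>i<n. (x i)\<^sup>2) = (\<Sum>l<n. (\<Sum>i<n. q l i * x i)\<^sup>2)"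
    and S: "S \<subseteq> {..<n}" and F: "finite F"
    and upper: "\<And>x. \<forall>i. i \<notin> S \<longrightarrow> x i = 0 \<Longrightarrow> \<forall>f\<in>F. (\<Sum>i\<in>S. f i * x i) = 0 \<Longrightarrow>
      (\<Sum>i\<in>S. \<Sum>j\<in>S. a i j * x i * x j) \<le> c * (\<Sum>i\<in>S. (x i)\<^sup>2)"
  shows "card S \<le> card {l. l < n \<and> d l \<le> c} + card F"
proof -
  have "card S \<le> card {l. l < n \<and> - d l \<ge> - c} + card F"
  proof (rule card_diagonal_entries_ge[where a = "\<lambda>i j. - a i j" and d = "\<lambda>l. - d l" and q = q])
    show "(\<Sum>i<n. (x i)\<^sup>2) = (\<Sum>l<n. (\<Sum>i<n. q l i * x i)\<^sup>2)" for x
      by (rule norm)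
    show "(\<Sum>i<n. \<Sum>j<n. - a i j * x i * x j) = (\<Sum>l<n. - d l * (\<Sum>i<n. q l i * x i)\<^sup>2)" for x
      using form[of x] by (simp add: sum_negf)
    show "- c * (\<Sum>i\<in>S. (x i)\<^sup>2) \<le> (\<Sum>i\<in>S. \<Sum>j\<in>S. - a i j * x i * x j)"
      if "\<forall>i. i \<notin> S \<longrightarrow> x i = 0" "\<forall>f\<in>F. (\<Sum>i\<in>S. f i * x i) = 0" for x
      using upper[OF that] by (simp add: sum_negf)
  qed (use S F in auto)
  then show ?thesis
    by simp
qed

section \<open>From counts of eigenvalues to the ordered spectrum\<close>

lemma kth_largest_ge:
  fixes xs :: "'a :: linorder list"
  assumes "sorted xs" "1 \<le> k" "k \<le> length (filter (\<lambda>x. x \<ge> c) xs)"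
  shows "rev xs ! (k - 1) \<ge> c"
proof (rule ccontr)
  assume neg: "\<not> ?thesis"
  have k: "k \<le> length xs"
    using assms(3) length_filter_le[of "\<lambda>x. x \<ge> c" xs] by linarith
  have "xs ! (length xs - k) < c"
    using neg k assms(2) by (simp add: rev_nth)
  have "{i. i < length xs \<and> xs ! i \<ge> c} \<subseteq> {length xs - k<..<length xs}"
  proof clarify
    fix i assume i: "i < length xs" "xs ! i \<ge> c"
    have "\<not> i \<le> length xs - k"
    proof
      assume "i \<le> length xs - k"
      then have "xs ! i \<le> xs ! (length xs - k)"
        using assms(1,2) k by (intro sorted_nth_mono) auto
      with i(2) \<open>xs ! (length xs - k) < c\<close> show False
        by simp
    qed
    with i show "i \<in> {length xs - k<..<length xs}"
      by simp
  qed
  from card_mono[OF _ this] show False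
    using assms(2,3) k by (simp add: length_filter_conv_card)
qed

lemma kth_smallest_le:
  fixes xs :: "'a :: linorder list"
  assumes "sorted xs" "1 \<le> k" "k \<le> length (filter (\<lambda>x. x \<le> c) xs)"
  shows "xs ! (k - 1) \<le> c"
proof (rule ccontr)
  assume neg: "\<not> ?thesis"
  have "{i. i < length xs \<and> xs ! i \<le> c} \<subseteq> {..<k - 1}"
  proof
    fix i assume "i \<in> {i. i < length xs \<and> xs ! i \<le> c}"
    then have i: "i < length xs" "xs ! i \<le> c"
      by auto
    show "i \<in> {..<k - 1}"
    proof (rule ccontr)
      assume "i \<notin> {..<k - 1}"
      then have "xs ! (k - 1) \<le> xs ! i"
        using assms(1) i(1) by (intro sorted_nth_mono) auto
      with i(2) neg show False
        by simp
    qed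
  qed
  from card_mono[OF _ this] show False
    using assms(2,3) by (simp add: length_filter_conv_card)
qed

lemma length_filter_sorted_list_of_multiset:
  assumes "M = image_mset d (mset_set {..<n :: nat})"
  shows "length (filter p (sorted_list_of_multiset M)) = card {l. l < n \<and> p (d l)}"
proof -
  have "length (filter p (sorted_list_of_multiset M)) = size (filter_mset p M)"
    by (metis mset_filter mset_sorted_list_of_multiset size_mset)
  also have "\<dots> = card {l. l < n \<and> p (d l)}"
    by (simp add: assms filter_mset_image_mset)
  finally show ?thesis .
qed

section \<open>Eigenvalue bounds from cliques and independent sets\<close>

text \<open>
  On a clique the adjacency matrix is the all-ones matrix minus the identity. Hence its form is at
  least \<open>- 1\<close> times the squared norm everywhere, and equal to that on the hyperplane
  \<open>(\<Sum>i\<in>S. x i) = 0\<close>.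
\<close>

lemma quadratic_form_clique:
  fixes x :: "'v \<Rightarrow> real"
  assumes "finite S" "\<And>i j. i \<in> S \<Longrightarrow> j \<in> S \<Longrightarrow> a i j = (if i = j then 0 else 1)"
  shows "(\<Sum>i\<in>S. \<Sum>j\<in>S. a i j * x i * x j) = (\<Sum>i\<in>S. x i)\<^sup>2 - (\<Sum>i\<in>S. (x i)\<^sup>2)"
proof -
  have "(\<Sum>i\<in>S. \<Sum>j\<in>S. a i j * x i * x j) =
      (\<Sum>i\<in>S. \<Sum>j\<in>S. x i * x j - (if i = j then (x i)\<^sup>2 else 0))"
    using assms(2) by (intro sum.cong refl) (auto simp: power2_eq_square)
  also have "\<dots> = (\<Sum>i\<in>S. x i)\<^sup>2 - (\<Sum>i\<in>S. (x i)\<^sup>2)"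
    using assms(1) by (simp add: sum_subtractf power2_eq_square sum_product)
  finally show ?thesis .
qed

theorem theorem2p3:
  fixes k n :: nat and G :: "('a, 'b) pre_digraph"
  assumes "k \<ge> 1"
    and "n \<ge> (2 * k - 1) choose (k - 1)"
    and "graph G"
    and "card (verts G) = n"
  shows "graph_eigenvalue G k \<ge> - 1 \<and> graph_eigenvalue G (n - k + 1) \<le> 0"
proof -
  interpret graph G by fact
  obtain vs where vs: "set vs = verts G" "distinct vs"
    using finite_distinct_list[OF finite_verts] by auto
  have n: "length vs = n"
    using vs assms(4) distinct_card by fastforce
  define E where "E i j \<longleftrightarrow> (vs ! i, vs ! j) \<in> arcs_ends G" for i j
  define A where "A = adjacency_matrix G vs"
  have A: "A \<in> carrier_mat n n"
    by (simp add: A_def n[symmetric])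
  have a: "A $$ (i, j) = (if E i j then 1 else 0)" if "i < n" "j < n" for i j
    using that by (simp add: A_def adjacency_matrix_def n E_def)
  have symE: "symp E"
    using sym_arcs by (auto intro!: sympI simp: E_def symmetric_def dest: symD)
  have irrefl: "\<not> E i i" for i
    using no_loops by (auto simp: E_def arcs_ends_def arc_to_ends_def) metis
  have "transpose_mat A = A"
    using A symE by (intro eq_matI) (auto simp: a dest: sympD)
  from real_symmetric_quadratic_form_diagonal[OF A this]
  obtain d q where roots: "proots (char_poly A) = image_mset d (mset_set {..<n})"
    and form: "\<And>x. (\<Sum>i<n. \<Sum>j<n. A $$ (i, j) * x i * x j) = (\<Sum>l<n. d l * (\<Sum>i<n. q l i * x i)\<^sup>2)"
    and norm: "\<And>x. (\<Sum>i<n. (x i)\<^sup>2) = (\<Sum>l<n. (\<Sum>i<n. q l i * x i)\<^sup>2)"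
    by blast
  note count_ge = card_diagonal_entries_ge[OF form norm]
    and count_le = card_diagonal_entries_le[OF form norm]
  have "(k + (k - 1)) choose k = (2 * k - 1) choose (k - 1)"
    using assms(1) binomial_symmetric[of k "2 * k - 1"] by (simp add: mult_2)
  then have "card {..<n} \<ge> (k + (k - 1)) choose k"
    using assms(2) by simp
  from ramsey_binomial[OF symE finite_lessThan this]
  have counts: "k \<le> card {l. l < n \<and> d l \<ge> - 1} \<and> k \<le> card {l. l < n \<and> d l \<le> 0}"
  proof (elim disjE exE conjE)
    fix S assume S: "S \<subseteq> {..<n}" "card S = Suc k" "pairwise E S"
    have Q: "(\<Sum>i\<in>S. \<Sum>j\<in>S. A $$ (i, j) * x i * x j) = (\<Sum>i\<in>S. x i)\<^sup>2 - (\<Sum>i\<in>S. (x i)\<^sup>2)"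
      for x :: "nat \<Rightarrow> real"
    proof (rule quadratic_form_clique)
      show "A $$ (i, j) = (if i = j then 0 else 1)" if "i \<in> S" "j \<in> S" for i j
      proof -
        have "i < n" "j < n"
          using that S(1) by auto
        then show ?thesis
          using that S(3) irrefl by (auto simp: a pairwise_def)
      qed
    qed (use S finite_subset in auto)
    have "card S \<le> card {l. l < n \<and> d l \<ge> - 1} + card ({} :: (nat \<Rightarrow> real) set)"
      by (rule count_ge[OF S(1)]) (auto simp: Q)
    \<comment> \<open>the constant functional cuts out the hyperplane of vectors with coordinate sum zero\<close>
    moreover have "card S \<le> card {l. l < n \<and> d l \<le> 0} + card {\<lambda>i::nat. 1::real}"
      by (rule count_le[OF S(1)]) (auto simp: Q intro: sum_nonneg)
    ultimately show ?thesis
      using S(2) by simp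
  next
    fix S assume S: "S \<subseteq> {..<n}" "card S = Suc (k - 1)" "pairwise (\<lambda>i j. \<not> E i j) S"
    have "A $$ (i, j) = 0" if "i \<in> S" "j \<in> S" for i j
    proof -
      have "i < n" "j < n"
        using that S(1) by auto
      then show ?thesis
        using that S(3) irrefl by (cases "i = j") (auto simp: a pairwise_def)
    qed
    then have Q: "(\<Sum>i\<in>S. \<Sum>j\<in>S. A $$ (i, j) * x i * x j) = 0" for x :: "nat \<Rightarrow> real"
      by simp
    have "card S \<le> card {l. l < n \<and> d l \<ge> - 1} + card ({} :: (nat \<Rightarrow> real) set)"
      by (rule count_ge[OF S(1)]) (auto simp: Q intro: sum_nonneg)
    moreover have "card S \<le> card {l. l < n \<and> d l \<le> 0} + card ({} :: (nat \<Rightarrow> real) set)"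
      by (rule count_le[OF S(1)]) (auto simp: Q)
    ultimately show ?thesis
      using S(2) assms(1) by simp
  qed
  have spec: "graph_spectrum G = image_mset d (mset_set {..<n})"
    using graph_spectrum_eq[OF vs(2,1)] roots by (simp add: A_def)
  define xs where "xs = sorted_list_of_multiset (graph_spectrum G)"
  have sorted: "sorted xs" and len: "length xs = n"
    using length_filter_sorted_list_of_multiset[OF spec, of "\<lambda>_. True"]
    by (simp_all add: xs_def)
  note filter_len = length_filter_sorted_list_of_multiset[OF spec, folded xs_def]
  have "rev xs ! (k - 1) \<ge> - 1"
    using counts assms(1) by (intro kth_largest_ge[OF sorted]) (auto simp: filter_len)
  moreover have "xs ! (k - 1) \<le> 0"
    using counts assms(1) by (intro kth_smallest_le[OF sorted]) (auto simp: filter_len)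
  moreover have "rev xs ! (n - k) = xs ! (k - 1)"
  proof -
    have "card {l. l < n \<and> d l \<le> 0} \<le> card {..<n}"
      by (intro card_mono) auto
    then have "k \<le> n"
      using counts by simp
    then show ?thesis
      using assms(1) len by (simp add: rev_nth)
  qed
  ultimately show ?thesis
    by (simp add: graph_eigenvalue_def xs_def)
qed

end
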